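(* Let $p$ be a prime number and let $V$ be a faithful, finite-dimensional representation of $G=\mathbb{Z}/p\mathbb{Z}$ over the field $\mathbb{R}$ of real numbers. Then $$\beta_{\mathrm{sep}}(G,V)=p.$$
   Context: $\mathbb{R}[V]^G$ is the ring of $G$-invariant polynomial functions on $V$. A subset $E\subseteq\mathbb{R}[V]^G$ is a separating set if for all $v,w\in V$: whenever some $f\in\mathbb{R}[V]^G$ has $f(v)\neq f(w)$, some $f\in E$ has $f(v)\neq f(w)$. $\beta_{\mathrm{sep}}(G,V)$ is the least natural number $d$ such that the invariant polynomials of degree at most $d$ form a separating set. *)

theory Defs
  imports
    "HOL-Analysis.Analysis"
    "HOL-Algebra.Group_Action"
    "HOL-Algebra.Elementary_Groups"
begin

text \<open>
  The representation space is a real vector space type, and polynomial functions on it are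
  described without choosing coordinates: the library's \<^const>\<open>real_polynomial_function\<close> is
  refined by a degree bound and freed from the norm.  The functions satisfying
  \<open>poly_fun_deg_le d\<close> are the sums of products of at most \<open>d\<close> linear functionals, that is,
  the polynomials of total degree at most \<open>d\<close> in the coordinates of any basis.
\<close>

inductive poly_fun_deg_le :: "nat \<Rightarrow> ('v::real_vector \<Rightarrow> real) \<Rightarrow> bool" where
  const: "poly_fun_deg_le d (\<lambda>v. c)"
| linear: "linear f \<Longrightarrow> poly_fun_deg_le 1 f"
| add: "poly_fun_deg_le d f \<Longrightarrow> poly_fun_deg_le d g \<Longrightarrow> poly_fun_deg_le d (\<lambda>v. f v + g v)"
| mult: "poly_fun_deg_le d f \<Longrightarrow> poly_fun_deg_le e g \<Longrightarrow>
    poly_fun_deg_le (d + e) (\<lambda>v. f v * g v)"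

lemma poly_fun_deg_le_mono:
  assumes "poly_fun_deg_le d f" and "d \<le> e"
  shows "poly_fun_deg_le e f"
  using poly_fun_deg_le.mult[OF assms(1) poly_fun_deg_le.const[of "e - d" 1]] assms(2) by simp

text \<open>On Euclidean spaces the polynomial functions are those of the library.\<close>

lemma poly_fun_deg_le_iff_real_polynomial_function:
  fixes f :: "'v::euclidean_space \<Rightarrow> real"
  shows "(\<exists>d. poly_fun_deg_le d f) \<longleftrightarrow> real_polynomial_function f"
proof
  assume "\<exists>d. poly_fun_deg_le d f"
  then obtain d where "poly_fun_deg_le d f" ..
  then show "real_polynomial_function f"
    by induction (auto simp: linear_conv_bounded_linear)
next
  assume "real_polynomial_function f"
  then show "\<exists>d. poly_fun_deg_le d f"
  proof induction
    case (linear f)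
    then show ?case
      by (blast intro: poly_fun_deg_le.linear bounded_linear.linear)
  next
    case (const c)
    then show ?case
      by (auto intro: poly_fun_deg_le.const)
  next
    case (add f g)
    then obtain d e where "poly_fun_deg_le d f" "poly_fun_deg_le e g"
      by blast
    then have "poly_fun_deg_le (max d e) f" "poly_fun_deg_le (max d e) g"
      by (auto elim: poly_fun_deg_le_mono)
    then show ?case
      by (blast intro: poly_fun_deg_le.add)
  next
    case (mult f g)
    then show ?case
      by (blast intro: poly_fun_deg_le.mult)
  qed
qed

definition poly_fun_degree :: "('v::real_vector \<Rightarrow> real) \<Rightarrow> nat" where
  "poly_fun_degree f = (LEAST d. poly_fun_deg_le d f)"

lemma poly_fun_degree_le_iff:
  assumes "poly_fun_deg_le e f"
  shows "poly_fun_degree f \<le> d \<longleftrightarrow> poly_fun_deg_le d f"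
  unfolding poly_fun_degree_def
  using assms by (metis LeastI Least_le poly_fun_deg_le_mono)

locale linear_representation =
  group_action G "UNIV :: 'v::real_vector set" \<rho>
  for G (structure) and \<rho> +
  assumes linear_rep: "g \<in> carrier G \<Longrightarrow> linear (\<rho> g)"

locale faithful_linear_representation =
  linear_representation G \<rho> + faithful_action G "UNIV :: 'v::real_vector set" \<rho>
  for G (structure) and \<rho>

definition invariant_polys ::
    "('g, 'm) monoid_scheme \<Rightarrow> ('g \<Rightarrow> 'v::real_vector \<Rightarrow> 'v) \<Rightarrow> ('v \<Rightarrow> real) set" where
  "invariant_polys G \<rho> =
    {f. (\<exists>d. poly_fun_deg_le d f) \<and> (\<forall>g\<in>carrier G. \<forall>v. f (\<rho> g v) = f v)}"

definition separating_set ::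
    "('g, 'm) monoid_scheme \<Rightarrow> ('g \<Rightarrow> 'v::real_vector \<Rightarrow> 'v) \<Rightarrow> ('v \<Rightarrow> real) set \<Rightarrow> bool" where
  "separating_set G \<rho> E \<longleftrightarrow>
    E \<subseteq> invariant_polys G \<rho> \<and>
    (\<forall>v w. (\<exists>f\<in>invariant_polys G \<rho>. f v \<noteq> f w) \<longrightarrow> (\<exists>f\<in>E. f v \<noteq> f w))"

definition beta_sep ::
    "('g, 'm) monoid_scheme \<Rightarrow> ('g \<Rightarrow> 'v::real_vector \<Rightarrow> 'v) \<Rightarrow> nat" where
  "beta_sep G \<rho> = (LEAST d. separating_set G \<rho> {f \<in> invariant_polys G \<rho>. poly_fun_degree f \<le> d})"

end

theory Submission
  imports Defs
begin

text \<open>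
  Two points in different orbits are separated by a product of translates of a generic linear
  functional, an invariant whose degree is the order of the group; this is the upper bound.

  For the lower bound, let \<open>T\<close> be the action of a generator. Fourier analysis of a vector moved
  by \<open>T\<close> gives a nonzero real linear map \<open>\<phi>\<close> from the complex plane to \<open>V\<close> with
  \<open>\<phi> (\<zeta> z) = T (\<phi> z)\<close> for some nontrivial \<open>p\<close>-th root of unity \<open>\<zeta>\<close>. An invariant \<open>f\<close> of degree
  \<open>d < p\<close> pulls back to a trigonometric polynomial of degree at most \<open>d\<close> on the unit circle which
  is unchanged by multiplication with \<open>\<zeta>\<close>, so it is constant there. But the image of the circle
  is infinite and hence not contained in one orbit.
\<close>

section \<open>Separation by invariants of degree at most the group order\<close>

text \<open>Finitely many proper subspaces do not cover the dual space. Inductively, a functional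
  \<open>m\<close> with \<open>m a = 1\<close> is added to the old \<open>l\<close> with a factor
  \<open>t\<close> that avoids finitely many bad values.\<close>

lemma linear_functional_avoiding:
  fixes F :: "'v::real_vector set"
  assumes "finite F" and "0 \<notin> F"
  shows "\<exists>l :: 'v \<Rightarrow> real. linear l \<and> (\<forall>u\<in>F. l u \<noteq> 0)"
  using assms
proof (induction F)
  case empty
  show ?case
    by (intro exI[of _ "\<lambda>_. 0"]) (simp add: linear_zero)
next
  case (insert a F)
  then obtain l :: "'v \<Rightarrow> real" where l: "linear l" "\<forall>u\<in>F. l u \<noteq> 0"
    by auto
  have "independent {a}"
    using insert.prems by simp
  then obtain m :: "'v \<Rightarrow> real" where m: "linear m" "m a = 1"
    using linear_independent_extend[of "{a}" "\<lambda>_. 1"] by auto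
  have "finite ((\<lambda>u. - l u / m u) ` insert a F)"
    using insert.hyps by simp
  \<comment> \<open>If \<open>m u = 0\<close>, then \<open>u\<close> lies in the old set and
    \<open>l u\<close> is already nonzero; division by zero then merely excludes
    \<open>t = 0\<close> as well.\<close>
  then obtain t where t: "t \<notin> (\<lambda>u. - l u / m u) ` insert a F"
    using ex_new_if_finite infinite_UNIV_char_0 by blast
  have "l u + t * m u \<noteq> 0" if "u \<in> insert a F" for u
  proof (cases "m u = 0")
    case True
    then show ?thesis
      using that l m by auto
  next
    case False
    then show ?thesis
      using t that by (auto simp: field_simps eq_neg_iff_add_eq_0 image_iff)
  qed
  moreover have "linear (\<lambda>u. l u + t * m u)"
    using linear_compose_add[OF l(1) linear_compose_scale_right[OF m(1), of t]] by simp
  ultimately show ?case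
    by (intro exI[of _ "\<lambda>u. l u + t * m u"]) auto
qed

lemma poly_fun_deg_le_prod:
  assumes "finite A" and "\<And>a. a \<in> A \<Longrightarrow> poly_fun_deg_le 1 (F a)"
  shows "poly_fun_deg_le (card A) (\<lambda>x. \<Prod>a\<in>A. F a x)"
  using assms
proof (induction A)
  case empty
  show ?case
    by (simp add: poly_fun_deg_le.const)
next
  case (insert a A)
  then show ?case
    using poly_fun_deg_le.mult[of 1 "F a" "card A"] by simp
qed

context linear_representation
begin

lemma invariant_separating_orbits:
  assumes "finite (carrier G)" and "\<And>g. g \<in> carrier G \<Longrightarrow> \<rho> g v \<noteq> w"
  shows "\<exists>f\<in>invariant_polys G \<rho>. poly_fun_degree f \<le> card (carrier G) \<and> f v \<noteq> f w"
proof -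
  interpret group G
    by (rule group_hom.axioms(1)[OF group_hom])
  have "finite ((\<lambda>g. \<rho> g v - w) ` carrier G)" "0 \<notin> (\<lambda>g. \<rho> g v - w) ` carrier G"
    using assms by auto
  from linear_functional_avoiding[OF this]
  obtain l where l: "linear l" "\<And>g. g \<in> carrier G \<Longrightarrow> l (\<rho> g v - w) \<noteq> (0::real)"
    by blast
  \<comment> \<open>Each factor is \<open>l (\<rho> g x - w)\<close>. At \<open>x = w\<close> the
    factor of the identity vanishes; at \<open>x = v\<close> no factor does, by the choice of
    \<open>l\<close>.\<close>
  define f where "f x = (\<Prod>g\<in>carrier G. l (\<rho> g x) + (- l w))" for x
  have "poly_fun_deg_le 1 (\<lambda>x. l (\<rho> g x) + (- l w))" if "g \<in> carrier G" for g
    using linear_compose[OF linear_rep[OF that] l(1)]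
    by (intro poly_fun_deg_le.add poly_fun_deg_le.const poly_fun_deg_le.linear) (simp add: o_def)
  then have deg: "poly_fun_deg_le (card (carrier G)) f"
    unfolding f_def by (rule poly_fun_deg_le_prod[OF assms(1)])
  have "f (\<rho> h x) = f x" if "h \<in> carrier G" for h x
    unfolding f_def
    by (rule prod.reindex_bij_witness[of _ "\<lambda>g. g \<otimes> inv h" "\<lambda>g. g \<otimes> h"])
      (use that in \<open>auto simp: m_assoc composition_rule\<close>)
  then have "f \<in> invariant_polys G \<rho>"
    using deg by (auto simp: invariant_polys_def)
  moreover have "f w = 0"
    unfolding f_def using assms(1) fun_cong[OF id_eq_one, of w]
    by (intro prod_zero bexI[of _ \<one>]) auto
  moreover have "f v \<noteq> 0"
    unfolding f_def using assms(1) l by (auto simp: linear_diff)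
  ultimately show ?thesis
    using deg poly_fun_degree_le_iff[OF deg] by metis
qed

lemma separating_set_card:
  assumes "finite (carrier G)"
  shows "separating_set G \<rho> {f \<in> invariant_polys G \<rho>. poly_fun_degree f \<le> card (carrier G)}"
  unfolding separating_set_def
proof (intro conjI allI impI)
  fix v w
  assume "\<exists>f\<in>invariant_polys G \<rho>. f v \<noteq> f w"
  then have "\<rho> g v \<noteq> w" if "g \<in> carrier G" for g
    using that by (auto simp: invariant_polys_def)
  from invariant_separating_orbits[OF assms this]
  show "\<exists>f\<in>{f \<in> invariant_polys G \<rho>. poly_fun_degree f \<le> card (carrier G)}. f v \<noteq> f w"
    by blast
qed auto

end

section \<open>Polynomial functions on a circle\<close>

text \<open>Multiplying by \<open>z ^ d\<close> turns a Laurent polynomial in \<open>z\<close> into a polynomial.\<close>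

lemma poly_fun_deg_le_on_circle:
  fixes \<phi> :: "complex \<Rightarrow> 'v::real_vector"
  assumes "poly_fun_deg_le d f" and "linear \<phi>"
  shows "\<exists>q. degree q \<le> 2 * d \<and> (\<forall>z. norm z = 1 \<longrightarrow> of_real (f (\<phi> z)) * z ^ d = poly q z)"
  using assms(1)
proof induction
  case (const d c)
  show ?case
    by (intro exI[of _ "monom (of_real c) d"]) (simp add: poly_monom order_trans[OF degree_monom_le])
next
  case (linear f)
  define a b where "a = complex_of_real (f (\<phi> 1))" and "b = complex_of_real (f (\<phi> \<i>))"
  have lin: "linear (f \<circ> \<phi>)"
    using linear linear_compose[OF assms(2)] by blast
  \<comment> \<open>On the circle the conjugate of \<open>z\<close> is \<open>1 / z\<close>, so
    \<open>Re z * z = (z^2 + 1) / 2\<close> and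
    \<open>Im z * z = (z^2 - 1) / (2 * \<i>)\<close>.\<close>
  have "of_real (f (\<phi> z)) * z = poly [:(a + \<i> * b) / 2, 0, (a - \<i> * b) / 2:] z"
    if "norm z = 1" for z
  proof -
    have "f (\<phi> z) = (f \<circ> \<phi>) (Re z *\<^sub>R 1 + Im z *\<^sub>R \<i>)"
      by (simp add: complex_eq scaleR_conv_of_real mult.commute flip: complex_eq)
    also have "\<dots> = Re z * f (\<phi> 1) + Im z * f (\<phi> \<i>)"
      by (simp only: linear_add[OF lin] linear_scale[OF lin]) simp
    finally have *: "complex_of_real (f (\<phi> z)) = of_real (Re z) * a + of_real (Im z) * b"
      by (simp add: a_def b_def)
    have "(Re z)\<^sup>2 + (Im z)\<^sup>2 = 1"
      using that by (metis cmod_power2 one_power2)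
    then show ?thesis
      unfolding * by (simp add: complex_eq_iff field_simps power2_eq_square a_def b_def) algebra
  qed
  then show ?case
    by (intro exI[of _ "[:(a + \<i> * b) / 2, 0, (a - \<i> * b) / 2:]"]) auto
next
  case (add d f g)
  then obtain q r where "degree q \<le> 2 * d" "degree r \<le> 2 * d"
    "\<forall>z. norm z = 1 \<longrightarrow> of_real (f (\<phi> z)) * z ^ d = poly q z"
    "\<forall>z. norm z = 1 \<longrightarrow> of_real (g (\<phi> z)) * z ^ d = poly r z"
    by blast
  then show ?case
    by (intro exI[of _ "q + r"]) (auto simp: degree_add_le algebra_simps)
next
  case (mult d f e g)
  then obtain q r where qr: "degree q \<le> 2 * d" "degree r \<le> 2 * e"
    "\<forall>z. norm z = 1 \<longrightarrow> of_real (f (\<phi> z)) * z ^ d = poly q z"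
    "\<forall>z. norm z = 1 \<longrightarrow> of_real (g (\<phi> z)) * z ^ e = poly r z"
    by blast
  have "degree (q * r) \<le> 2 * (d + e)"
    using degree_mult_le[of q r] qr(1,2) by simp
  moreover have "of_real (f (\<phi> z) * g (\<phi> z)) * z ^ (d + e) = poly (q * r) z"
    if "norm z = 1" for z
    using qr(3,4) that by (simp add: power_add flip: mult.assoc) (metis mult.assoc mult.commute)
  ultimately show ?case
    by blast
qed

lemma root_of_unity_power_eq_iff:
  fixes z :: "'a::idom"
  assumes "prime p" and "z ^ p = 1" and "z \<noteq> 1"
  shows "z ^ n = 1 \<longleftrightarrow> p dvd n"
proof
  assume n: "z ^ n = 1"
  show "p dvd n"
  proof (rule ccontr)
    assume "\<not> p dvd n"
    then have "coprime p n"
      using assms(1) by (simp add: prime_imp_coprime)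
    moreover have "p \<noteq> 0"
      using assms(1) by auto
    ultimately obtain x y where "p * x = n * y + 1"
      using bezout_nat[of p n] by auto
    then have "(z ^ p) ^ x = (z ^ n) ^ y * z"
      by (metis power_add power_mult power_one_right)
    then show False
      using assms n by simp
  qed
qed (use assms in \<open>auto simp: power_mult\<close>)

text \<open>A finite connected set has at most one point, but the circle contains both 1 and
  -1.\<close>

lemma infinite_unit_circle: "infinite (sphere (0::complex) 1)"
proof
  assume "finite (sphere (0::complex) 1)"
  then obtain a :: complex where "sphere 0 1 \<subseteq> {a}"
    using connected_finite_iff_sing[of "sphere (0::complex) 1"]
      connected_sphere[of "0::complex" 1] by auto
  then have "(1::complex) \<in> {a}" "(-1::complex) \<in> {a}"
    by force+
  then show False
    by simp
qed

lemma invariant_constant_on_circle: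
  fixes \<phi> :: "complex \<Rightarrow> 'v::real_vector"
  assumes f: "poly_fun_deg_le d f" "linear \<phi>"
    and p: "prime p" "d < p"
    and \<zeta>: "\<zeta> ^ p = 1" "\<zeta> \<noteq> 1"
    and inv: "\<And>z. f (\<phi> (\<zeta> * z)) = f (\<phi> z)"
    and z: "norm z = 1" "norm w = 1"
  shows "f (\<phi> z) = f (\<phi> w)"
proof -
  obtain q where q: "degree q \<le> 2 * d"
    "\<And>z. norm z = 1 \<Longrightarrow> of_real (f (\<phi> z)) * z ^ d = poly q z"
    using poly_fun_deg_le_on_circle[OF f] by blast
  have "p > 0"
    using p by simp
  then have \<zeta>1: "norm \<zeta> = 1"
    using \<zeta>(1) power_eq_1_iff by blast
  \<comment> \<open>Invariance gives \<open>q(\<zeta> z) = \<zeta>^d q(z)\<close> on the infinite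
    circle, hence as polynomials. Each coefficient of \<open>q\<close> is thus killed by
    \<open>\<zeta>^i - \<zeta>^d\<close>.\<close>
  define r where "r = q \<circ>\<^sub>p [:0, \<zeta>:] - smult (\<zeta> ^ d) q"
  have "poly r z = 0" if "norm z = 1" for z
    using that q(2)[of z] q(2)[of "\<zeta> * z"] \<zeta>1 inv[of z]
    by (simp add: r_def poly_pcompose norm_mult power_mult_distrib mult.left_commute mult.commute)
  then have "sphere 0 1 \<subseteq> {z. poly r z = 0}"
    by auto
  then have "r = 0"
    using infinite_unit_circle poly_roots_finite finite_subset by blast
  have "coeff q i = 0" if "i \<noteq> d" for i
  proof (rule ccontr)
    assume nz: "coeff q i \<noteq> 0"
    then have "i \<le> 2 * d"
      using q(1) le_degree order_trans by blast
    have "coeff r i = 0"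
      using \<open>r = 0\<close> by simp
    then have eq: "\<zeta> ^ i = \<zeta> ^ d"
      using nz by (simp add: r_def coeff_pcompose_linear)
    have "\<zeta> \<noteq> 0"
      using \<zeta>1 by auto
    then have "\<zeta> ^ (max i d - min i d) = 1"
      using eq by (cases "i \<le> d") (simp_all add: power_diff max_def min_def)
    then have "p dvd max i d - min i d"
      using root_of_unity_power_eq_iff[OF p(1) \<zeta>] by blast
    \<comment> \<open>The distance of \<open>i\<close> from \<open>d\<close> is at most
      \<open>d < p\<close>, so it is divisible by \<open>p\<close> only if
      \<open>i = d\<close>.\<close>
    then show False
      using \<open>i \<le> 2 * d\<close> \<open>d < p\<close> \<open>i \<noteq> d\<close> by (auto dest!: dvd_imp_le simp: max_def min_def split: if_splits)
  qed
  then have "q = monom (coeff q d) d"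
    by (intro poly_eqI) auto
  then have "poly q z = coeff q d * z ^ d" for z
    by (metis poly_monom)
  then have "complex_of_real (f (\<phi> z)) = coeff q d" if "norm z = 1" for z
    using q(2)[OF that] that by auto
  then show ?thesis
    using z by (metis of_real_eq_iff)
qed

section \<open>Planes rotated by a map of finite order\<close>

lemma sum_power_root_of_unity:
  fixes x :: "'a::idom"
  assumes "x ^ p = 1" and "x \<noteq> 1"
  shows "(\<Sum>k<p. x ^ k) = 0"
proof -
  have "(x - 1) * (\<Sum>k<p. x ^ k) = 0"
    using assms(1) by (simp flip: power_diff_1_eq)
  then show ?thesis
    using assms(2) by simp
qed

text \<open>
  The map sought is the Fourier component \<open>\<phi> k\<close> below of the vector \<open>v\<close>, for a suitable frequency
  \<open>k \<noteq> 0\<close>: if all these vanished, Fourier inversion would express both \<open>v\<close> and \<open>T v\<close> by the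
  component of frequency 0, the average over the orbit.
\<close>

lemma ex_rotation_intertwiner:
  fixes T :: "'v::real_vector \<Rightarrow> 'v"
  assumes T: "linear T" and Tp: "\<And>x. (T ^^ p) x = x" and p: "p > 0" and v: "T v \<noteq> v"
  shows "\<exists>(\<zeta>::complex) \<phi> u. linear \<phi> \<and> \<zeta> ^ p = 1 \<and> \<zeta> \<noteq> 1 \<and>
    (\<forall>z. \<phi> (\<zeta> * z) = T (\<phi> z)) \<and> \<phi> u \<noteq> (0::'v)"
proof -
  define \<omega> where "\<omega> = cis (2 * pi / p)"
  have \<omega>p: "\<omega> ^ p = 1"
    using p by (simp add: \<omega>_def Complex.DeMoivre)
  then have \<omega>kp: "(\<omega> ^ k) ^ p = 1" for k
    by (metis mult.commute power_mult power_one)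
  have \<omega>0: "\<omega> \<noteq> 0"
    by (simp add: \<omega>_def)
  have \<omega>_neq: "\<omega> ^ m \<noteq> 1" if "0 < m" "m < p" for m
  proof -
    have "cis (2 * pi * real m / real p) = 1 \<longleftrightarrow> (\<exists>n::int. 2 * pi * real m / real p = 2 * n * pi)"
      by (auto simp: cis_conv_exp exp_eq_1)
    moreover have False if "2 * pi * real m / real p = 2 * n * pi" for n :: int
    proof -
      have "real m = n * real p"
        using that p by (simp add: field_simps)
      then have "int m = n * int p"
        by (metis of_int_eq_iff of_int_mult of_int_of_nat_eq)
      then have "int p dvd int m"
        by simp
      then show False
        using \<open>0 < m\<close> \<open>m < p\<close> by (auto dest: dvd_imp_le)
    qed
    moreover have "\<omega> ^ m = cis (2 * pi * real m / real p)"
      unfolding \<omega>_def Complex.DeMoivre by (simp add: mult_ac)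
    ultimately show ?thesis
      by auto
  qed
  define \<phi> where "\<phi> k z = (\<Sum>j<p. Re (inverse (\<omega> ^ k) ^ j * z) *\<^sub>R (T ^^ j) v)" for k z
  have lin: "linear (\<phi> k)" for k
    by (rule linearI) (simp_all add: \<phi>_def distrib_left scaleR_left_distrib sum.distrib scaleR_sum_right)
  have rot: "\<phi> k (\<omega> ^ k * z) = T (\<phi> k z)" for k z
  proof -
    define h where "h j = Re (inverse (\<omega> ^ k) ^ j * (\<omega> ^ k * z)) *\<^sub>R (T ^^ j) v" for j
    \<comment> \<open>The summand is periodic in \<open>j\<close>, so the sum may be shifted by one
      index, which is an application of \<open>T\<close>.\<close>
    have "h p = h 0"
      using Tp by (simp add: h_def power_inverse \<omega>kp)
    then have "(\<Sum>j<p. h j) = (\<Sum>j<p. h (Suc j))"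
      by (metis add.commute add_right_cancel sum.lessThan_Suc sum.lessThan_Suc_shift)
    moreover have "h (Suc j) = T (Re (inverse (\<omega> ^ k) ^ j * z) *\<^sub>R (T ^^ j) v)" for j
    proof -
      have "inverse (\<omega> ^ k) ^ Suc j * (\<omega> ^ k * z) = inverse (\<omega> ^ k) ^ j * z"
        using \<omega>0 by simp
      then show ?thesis
        unfolding h_def by (simp only: linear_scale[OF T] funpow.simps o_apply)
    qed
    then have "(\<Sum>j<p. h (Suc j)) = T (\<phi> k z)"
      by (simp only: \<phi>_def linear_sum[OF T])
    ultimately show ?thesis
      by (simp only: \<phi>_def h_def)
  qed
  have inversion: "(\<Sum>k<p. \<phi> k (\<omega> ^ (k * m))) = real p *\<^sub>R (T ^^ m) v" if "m < p" for m
  proof -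
    have *: "(\<Sum>k<p. Re (inverse (\<omega> ^ k) ^ j * \<omega> ^ (k * m))) = (if j = m then real p else 0)"
      if "j < p" for j
    proof -
      \<comment> \<open>Orthogonality of characters: \<open>x\<close> is \<open>\<omega>\<close> to
        the power \<open>m - j\<close>, a nontrivial \<open>p\<close>-th root of unity unless
        \<open>j = m\<close>.\<close>
      define x where "x = inverse (\<omega> ^ j) * \<omega> ^ m"
      have x: "inverse (\<omega> ^ k) ^ j * \<omega> ^ (k * m) = x ^ k" for k
        by (simp add: x_def power_mult_distrib power_inverse mult.commute[of j] mult.commute[of m] flip: power_mult)
      have "x ^ p = 1"
        by (simp add: x_def power_mult_distrib power_inverse \<omega>kp)
      have "x \<noteq> 1" if "j \<noteq> m"
      proof
        assume "x = 1"
        then have "\<omega> ^ m = \<omega> ^ j"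
          using \<omega>0 by (simp add: x_def field_simps)
        then have "\<omega> ^ (max m j - min m j) = 1"
          using \<omega>0 by (cases "m \<le> j") (simp_all add: power_diff max_def min_def)
        then show False
          using \<omega>_neq[of "max m j - min m j"] \<open>j < p\<close> \<open>m < p\<close> \<open>j \<noteq> m\<close> by (auto simp: max_def less_imp_diff_less split: if_splits)
      qed
      moreover have "x = 1" if "j = m"
        using that \<omega>0 by (simp add: x_def)
      ultimately show ?thesis
        using sum_power_root_of_unity[OF \<open>x ^ p = 1\<close>]
        by (auto simp: x simp flip: Re_sum)
    qed
    have "(\<Sum>k<p. \<phi> k (\<omega> ^ (k * m)))
        = (\<Sum>j<p. (\<Sum>k<p. Re (inverse (\<omega> ^ k) ^ j * \<omega> ^ (k * m))) *\<^sub>R (T ^^ j) v)"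
      unfolding \<phi>_def by (subst sum.swap) (simp add: scaleR_sum_left)
    also have "\<dots> = (\<Sum>j<p. if j = m then real p *\<^sub>R (T ^^ j) v else 0)"
      by (intro sum.cong refl) (simp add: * del: times_complex.sel)
    also have "\<dots> = real p *\<^sub>R (T ^^ m) v"
      using that by simp
    finally show ?thesis .
  qed
  have "\<exists>k u. 0 < k \<and> k < p \<and> \<phi> k u \<noteq> 0"
  proof (rule ccontr)
    assume "\<not> ?thesis"
    then have "\<phi> k u = 0" if "k \<noteq> 0" "k < p" for k u
      using that by auto
    then have "(\<Sum>k<p. \<phi> k (\<omega> ^ (k * m))) = (\<Sum>k<p. if k = 0 then \<phi> 0 1 else 0)" for m
      by (intro sum.cong) auto
    then have "real p *\<^sub>R (T ^^ m) v = \<phi> 0 1" if "m < p" for m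
      using inversion[OF that] p by simp
    \<comment> \<open>Both 0 and 1 are then admissible values of \<open>m\<close>, and comparing
      them yields \<open>T v = v\<close>.\<close>
    moreover have "1 < p"
      using p v Tp[of v] by (cases "p = 1") auto
    ultimately have "real p *\<^sub>R (T ^^ 1) v = real p *\<^sub>R (T ^^ 0) v"
      using p by metis
    then show False
      using v p by simp
  qed
  then obtain k u where "0 < k" "k < p" "\<phi> k u \<noteq> 0"
    by blast
  then show ?thesis
    using lin rot \<omega>kp \<omega>_neq by blast
qed

text \<open>A functional nonzero at \<open>\<phi> u\<close> maps the image onto a connected set of
  reals. Were it finite, it would be a single point, yet the normalised \<open>u\<close> and its
  negative have opposite nonzero values.\<close>

lemma infinite_linear_image_circle:
  fixes \<phi> :: "complex \<Rightarrow> 'v::real_vector"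
  assumes "linear \<phi>" and "\<phi> u \<noteq> 0"
  shows "infinite (\<phi> ` sphere 0 1)"
proof
  assume fin: "finite (\<phi> ` sphere 0 1)"
  obtain l :: "'v \<Rightarrow> real" where l: "linear l" "l (\<phi> u) \<noteq> 0"
    using linear_functional_avoiding[of "{\<phi> u}"] assms by auto
  define \<psi> where "\<psi> = l \<circ> \<phi>"
  have \<psi>: "linear \<psi>"
    unfolding \<psi>_def by (rule linear_compose[OF assms(1) l(1)])
  have "u \<noteq> 0"
    using assms by (auto simp: linear_0)
  define s where "s = u /\<^sub>R norm u"
  have s: "s \<in> sphere 0 1" "- s \<in> sphere 0 1" and "\<psi> s \<noteq> 0"
    using \<open>u \<noteq> 0\<close> l(2) by (simp_all add: s_def linear_scale[OF \<psi>]) (simp add: \<psi>_def)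
  have "connected (\<psi> ` sphere 0 1)"
    using \<psi> by (intro connected_continuous_image linear_continuous_on)
      (simp_all add: linear_conv_bounded_linear connected_sphere)
  moreover have "finite (\<psi> ` sphere 0 1)"
    unfolding \<psi>_def image_comp[symmetric] using fin by (rule finite_imageI)
  ultimately obtain a where "\<psi> ` sphere 0 1 \<subseteq> {a}"
    using connected_finite_iff_sing[of "\<psi> ` sphere 0 1"] by auto
  then have "\<psi> s \<in> {a}" "\<psi> (- s) \<in> {a}"
    using imageI[OF s(1), of \<psi>] imageI[OF s(2), of \<psi>] by (meson subsetD)+
  then have "\<psi> s = \<psi> (- s)"
    by simp
  then show False
    using \<open>\<psi> s \<noteq> 0\<close> by (simp add: linear_neg[OF \<psi>])
qed

section \<open>The separating Noether number\<close>

theorem proposition3p13: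
  fixes p :: nat
    and \<rho> :: "int \<Rightarrow> 'v::real_vector \<Rightarrow> 'v"
    and B :: "'v set"
  assumes "prime p"
    and "finite_dimensional_vector_space (scaleR :: real \<Rightarrow> 'v \<Rightarrow> 'v) B"
    and "faithful_linear_representation (integer_mod_group p) \<rho>"
  shows "beta_sep (integer_mod_group p) \<rho> = p"
proof -
  let ?G = "integer_mod_group p"
  interpret faithful_linear_representation ?G \<rho>
    by (rule assms(3))
  have p: "p > 1"
    using assms(1) by (rule prime_gt_1_nat)
  then have carr: "carrier ?G = {0..<int p}"
    by (simp add: carrier_integer_mod_group)
  then have fin: "finite (carrier ?G)" and card: "card (carrier ?G) = p"
    by simp_all
  have \<rho>0: "\<rho> 0 x = x" for x
    using id_eq_one by (auto simp: fun_eq_iff)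
  define T where "T = \<rho> 1"
  have one: "1 \<in> carrier ?G"
    using p carr by simp
  then have T: "linear T"
    unfolding T_def by (rule linear_rep)
  have Tn: "(T ^^ n) x = \<rho> (int n mod int p) x" for n x
  proof (induction n)
    case 0
    show ?case
      by (simp add: \<rho>0)
  next
    case (Suc n)
    have "int n mod int p \<in> carrier ?G"
      using p carr by simp
    with Suc one show ?case
      using composition_rule[of x 1 "int n mod int p"]
      by (simp add: T_def mod_simps)
  qed
  have "(T ^^ p) x = x" for x
    by (simp add: Tn \<rho>0)
  \<comment> \<open>Since \<open>p > 1\<close>, the residues 0 and 1 are distinct, and faithfulness
    keeps their actions apart.\<close>
  moreover have "T \<noteq> \<rho> 0"
    using inj_onD[OF faithful, of 1 0] p carr by (auto simp: T_def)
  then obtain v where "T v \<noteq> v"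
    using \<rho>0 by fastforce
  ultimately have "\<exists>(\<zeta>::complex) \<phi> u. linear \<phi> \<and> \<zeta> ^ p = 1 \<and> \<zeta> \<noteq> 1 \<and>
      (\<forall>z. \<phi> (\<zeta> * z) = T (\<phi> z)) \<and> \<phi> u \<noteq> 0"
    using p by (intro ex_rotation_intertwiner[OF T]) auto
  then obtain \<zeta> u and \<phi> :: "complex \<Rightarrow> 'v" where \<phi>: "linear \<phi>" "\<zeta> ^ p = 1" "\<zeta> \<noteq> 1"
    "\<And>z. \<phi> (\<zeta> * z) = T (\<phi> z)" "\<phi> u \<noteq> 0"
    by blast
  have "\<not> \<phi> ` sphere 0 1 \<subseteq> (\<lambda>g. \<rho> g (\<phi> 1)) ` carrier ?G"
    using infinite_linear_image_circle[OF \<phi>(1,5)] fin finite_subset by blast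
  then obtain w where w: "norm w = 1" "\<And>g. g \<in> carrier ?G \<Longrightarrow> \<rho> g (\<phi> 1) \<noteq> \<phi> w"
    by (metis image_eqI image_subsetI mem_sphere_0)
  show ?thesis
    unfolding beta_sep_def
  proof (rule Least_equality)
    show "separating_set ?G \<rho> {f \<in> invariant_polys ?G \<rho>. poly_fun_degree f \<le> p}"
      using separating_set_card[OF fin] by (simp add: card)
  next
    fix d
    assume "separating_set ?G \<rho> {f \<in> invariant_polys ?G \<rho>. poly_fun_degree f \<le> d}"
    \<comment> \<open>The two circle points lie in different orbits, so some invariant separates
      them; by assumption one of degree at most \<open>d\<close> must do so too.\<close>
    moreover have "\<exists>f\<in>invariant_polys ?G \<rho>. f (\<phi> 1) \<noteq> f (\<phi> w)"
      using invariant_separating_orbits[OF fin w(2)] by blast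
    ultimately obtain f where f: "f \<in> invariant_polys ?G \<rho>" "poly_fun_degree f \<le> d"
      "f (\<phi> 1) \<noteq> f (\<phi> w)"
      unfolding separating_set_def by blast
    have "poly_fun_deg_le d f"
      using f(1,2) poly_fun_degree_le_iff by (auto simp: invariant_polys_def)
    moreover have "f (\<phi> (\<zeta> * z)) = f (\<phi> z)" for z
      using f(1) one by (simp add: \<phi>(4) T_def invariant_polys_def)
    ultimately show "p \<le> d"
      using invariant_constant_on_circle[OF _ \<phi>(1) assms(1) _ \<phi>(2,3), of d f 1 w] f(3) w(1)
      by (metis norm_one not_le)
  qed
qed

end
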